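(* Let $K$ be a compact Hausdorff space, $\varphi$ a homeomorphism of $K$ into itself (that is, $\varphi:K\to K$ is continuous and injective, hence a homeomorphism onto its image) with $\varphi(K)\subsetneqq K$, and let $w\in C(K)$. Let $T$ be the operator on $C(K)$ defined by $(Tf)(k)=w(k)f(\varphi(k))$, and put $L=\bigcap_{n=0}^\infty\varphi^n(K)$, $M=K\setminus \mathrm{Int}_K L$. Then (I) $\sigma(T,C(M))$ is either the closed disk $\rho(T,C(M))\mathbb{D}$ or the singleton $\{0\}$; (II) $\sigma(T)=\sigma(T,C(M))\cup\sigma(T,C(L))$.
   Context: $C(K)$ is the Banach space of complex-valued continuous functions on $K$ with the sup norm. $\mathrm{Int}_K L$ is the interior of $L$ in $K$. For a closed set $F\subseteq K$ with $\varphi(F)\subseteq F$ (in particular $F=L$ or $F=M$), the same formula $(Tf)(k)=w(k)f(\varphi(k))$, $k\in F$, defines an operator on $C(F)$, again denoted $T$; $\sigma(T,C(F))$ and $\rho(T,C(F))$ denote its spectrum and spectral radius, and $\sigma(T)=\sigma(T,C(K))$. $\mathbb{D}$ is the closed unit disc. *)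

theory Defs
  imports "HOL-Analysis.Analysis"
begin

text \<open>The compact space \<open>K\<close> is a topology \<open>X\<close>. An element of \<open>C(F)\<close> is represented by its extension
  by zero to the whole type, so that equality of representatives is equality on \<open>F\<close> and the
  pointwise operations stay inside the carrier. All continuous functions on \<open>F\<close> occur; no
  continuity across the boundary of \<open>F\<close> is required.\<close>

definition C_space :: "'a topology \<Rightarrow> 'a set \<Rightarrow> ('a \<Rightarrow> complex) set" where
  "C_space X F =
     {f. continuous_map (subtopology X F) euclidean f \<and> (\<forall>x. x \<notin> F \<longrightarrow> f x = 0)}"

definition sup_norm :: "'a set \<Rightarrow> ('a \<Rightarrow> complex) \<Rightarrow> real" where
  "sup_norm F f = (SUP x\<in>F. cmod (f x))"

definition bounded_operator ::
  "'a topology \<Rightarrow> 'a set \<Rightarrow> (('a \<Rightarrow> complex) \<Rightarrow> ('a \<Rightarrow> complex)) \<Rightarrow> bool" where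
  "bounded_operator X F A \<longleftrightarrow>
     (\<forall>f\<in>C_space X F. A f \<in> C_space X F) \<and>
     (\<forall>f\<in>C_space X F. \<forall>g\<in>C_space X F. A (\<lambda>x. f x + g x) = (\<lambda>x. A f x + A g x)) \<and>
     (\<forall>c. \<forall>f\<in>C_space X F. A (\<lambda>x. c * f x) = (\<lambda>x. c * A f x)) \<and>
     (\<exists>B. \<forall>f\<in>C_space X F. sup_norm F (A f) \<le> B * sup_norm F f)"

definition invertible_operator ::
  "'a topology \<Rightarrow> 'a set \<Rightarrow> (('a \<Rightarrow> complex) \<Rightarrow> ('a \<Rightarrow> complex)) \<Rightarrow> bool" where
  "invertible_operator X F A \<longleftrightarrow>
     (\<exists>S. bounded_operator X F S \<and> (\<forall>f\<in>C_space X F. S (A f) = f \<and> A (S f) = f))"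

definition spectrum ::
  "'a topology \<Rightarrow> 'a set \<Rightarrow> (('a \<Rightarrow> complex) \<Rightarrow> ('a \<Rightarrow> complex)) \<Rightarrow> complex set" where
  "spectrum X F A = {c. \<not> invertible_operator X F (\<lambda>f x. c * f x - A f x)}"

definition spectral_radius ::
  "'a topology \<Rightarrow> 'a set \<Rightarrow> (('a \<Rightarrow> complex) \<Rightarrow> ('a \<Rightarrow> complex)) \<Rightarrow> real" where
  "spectral_radius X F A = (SUP c\<in>spectrum X F A. cmod c)"

text \<open>The next operator acts on \<open>C(F)\<close> when \<open>F\<close> is \<open>\<phi>\<close>-invariant; the value \<open>0\<close> off \<open>F\<close> is that
  of the representatives.\<close>

definition weighted_comp ::
  "'a set \<Rightarrow> ('a \<Rightarrow> complex) \<Rightarrow> ('a \<Rightarrow> 'a) \<Rightarrow> ('a \<Rightarrow> complex) \<Rightarrow> ('a \<Rightarrow> complex)" where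
  "weighted_comp F w \<phi> f = (\<lambda>k. if k \<in> F then w k * f (\<phi> k) else 0)"

end

theory Submission imports Defs begin

text \<open>Everything is read off from the growth of the weights
  \<open>w\<^sub>n(k) = w(k) w(\<phi> k) \<dots> w(\<phi>\<^sup>n\<^sup>-\<^sup>1 k)\<close>. If \<open>\<bar>w\<^sub>n\<bar> \<le> D q\<^sup>n\<close> on \<open>F\<close> with \<open>q < \<bar>z\<bar>\<close>, the Neumann
  series inverts \<open>z - T\<close> on \<open>C(F)\<close>. Conversely, a function \<open>g\<close> vanishing on \<open>\<phi>\<^sup>m(K)\<close> satisfies
  \<open>T\<^sup>m g = 0\<close>, so \<open>u = (\<Sum>j<m. z'\<^sup>-\<^sup>j\<^sup>-\<^sup>1 T\<^sup>j g)\<close> solves \<open>(z' - T) u = g\<close> for every \<open>z' \<noteq> 0\<close>.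
  When \<open>z - T\<close> is bounded below and \<open>z'\<close> is close to \<open>z\<close>, this bounds \<open>u\<close>; taking for \<open>g\<close> a bump at
  \<open>\<phi>\<^sup>i k\<close> that misses the rest of the orbit of \<open>k \<notin> L\<close> gives \<open>\<bar>w\<^sub>i(k)\<bar> \<le> D \<bar>z'\<bar>\<^sup>i\<close>, and by density
  the bound holds on \<open>M\<close>. With \<open>\<bar>z'\<bar> < \<bar>z\<bar>\<close> this makes the spectrum on \<open>C(M)\<close> a closed disc. The
  same decay on \<open>M \<inter> L\<close> forces solutions of \<open>z u = T u\<close> to vanish there, which allows solutions on
  \<open>M\<close> and \<open>L\<close> to be glued, and elements of the kernel on \<open>C(L)\<close> to be extended by zero.\<close>

section \<open>The function spaces \<open>C(F)\<close> and their sup norm\<close>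

lemma continuous_map_complex_mult:
  fixes f g :: "'a \<Rightarrow> complex"
  assumes "continuous_map X euclidean f" "continuous_map X euclidean g"
  shows "continuous_map X euclidean (\<lambda>x. f x * g x)"
  using assms by (simp add: continuous_map_atin tendsto_mult)

lemma continuous_map_complex_of_real:
  assumes "continuous_map X euclidean f"
  shows "continuous_map X euclidean (\<lambda>x. complex_of_real (f x))"
  using assms by (simp add: continuous_map_atin tendsto_of_real)

lemma continuous_map_complex_prod:
  fixes f :: "'i \<Rightarrow> 'a \<Rightarrow> complex"
  assumes "finite I" "\<And>i. i \<in> I \<Longrightarrow> continuous_map X euclidean (f i)"
  shows "continuous_map X euclidean (\<lambda>x. \<Prod>i\<in>I. f i x)"
  using assms by (simp add: continuous_map_atin tendsto_prod)

lemma C_spaceI: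
  assumes "continuous_map (subtopology X F) euclidean f"
  shows "(\<lambda>x. if x \<in> F then f x else 0) \<in> C_space X F"
  unfolding C_space_def
  using continuous_map_eq[OF assms, of "\<lambda>x. if x \<in> F then f x else 0"] by simp

lemma C_spaceD:
  assumes "f \<in> C_space X F"
  shows "continuous_map (subtopology X F) euclidean f" "\<And>x. x \<notin> F \<Longrightarrow> f x = 0"
  using assms by (auto simp: C_space_def)

lemma C_space_restrict:
  assumes "f \<in> C_space X E" "F \<subseteq> E"
  shows "(\<lambda>x. if x \<in> F then f x else 0) \<in> C_space X F"
  using C_spaceI[OF continuous_map_from_subtopology_mono[OF C_spaceD(1)[OF assms(1)] assms(2)]] .

lemma C_space_add:
  assumes "f \<in> C_space X F" "g \<in> C_space X F"
  shows "(\<lambda>x. f x + g x) \<in> C_space X F"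
  using assms by (auto simp: C_space_def intro: continuous_map_add)

lemma C_space_diff:
  assumes "f \<in> C_space X F" "g \<in> C_space X F"
  shows "(\<lambda>x. f x - g x) \<in> C_space X F"
  using assms by (auto simp: C_space_def intro: continuous_map_diff)

lemma C_space_scale:
  assumes "f \<in> C_space X F"
  shows "(\<lambda>x. c * f x) \<in> C_space X F"
  using assms by (auto simp: C_space_def intro: continuous_map_complex_mult)

lemma C_space_zero: "(\<lambda>x. 0) \<in> C_space X F"
  by (simp add: C_space_def)

text \<open>A closed subset of a compact space is compact, so the values are bounded and the
  supremum is a genuine one.\<close>

lemma norm_le_sup_norm:
  assumes "compact_space X" "closedin X F" "f \<in> C_space X F" "x \<in> F"
  shows "cmod (f x) \<le> sup_norm F f"
proof -
  have "compactin (subtopology X F) F"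
    using assms closedin_compact_space closedin_subset by (fastforce simp: compactin_subtopology)
  then have "compact (f ` F)"
    using image_compactin[OF _ C_spaceD(1)[OF assms(3)], of F] by simp
  then have "bdd_above ((\<lambda>x. cmod (f x)) ` F)"
    by (metis (no_types, lifting) bdd_above.I2 bounded_iff compact_imp_bounded image_eqI)
  then show ?thesis
    unfolding sup_norm_def using assms(4) by (rule cSUP_upper2) simp
qed

lemma sup_norm_le:
  assumes "F \<noteq> {}" "\<And>x. x \<in> F \<Longrightarrow> cmod (f x) \<le> b"
  shows "sup_norm F f \<le> b"
  unfolding sup_norm_def using assms by (intro cSUP_least) auto

lemma sup_norm_nonneg:
  assumes "compact_space X" "closedin X F" "f \<in> C_space X F" "F \<noteq> {}"
  shows "0 \<le> sup_norm F f"
  using norm_le_sup_norm[OF assms(1-3)] assms(4) by (meson ex_in_conv norm_ge_zero order_trans)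

section \<open>Invariant sets and the weights of the iterates\<close>

locale weighted_injection =
  fixes X :: "'a topology" and \<phi> :: "'a \<Rightarrow> 'a" and w :: "'a \<Rightarrow> complex"
  assumes compact: "compact_space X"
    and Hausdorff: "Hausdorff_space X"
    and cont_\<phi>: "continuous_map X X \<phi>"
    and inj_\<phi>: "inj_on \<phi> (topspace X)"
    and not_surj: "\<phi> ` topspace X \<subset> topspace X"
    and cont_w: "continuous_map X euclidean w"
begin

text \<open>Nonemptiness is included because pointwise bounds do not control \<open>sup_norm\<close>
  over the empty set.\<close>

definition closed_invariant :: "'a set \<Rightarrow> bool" where
  "closed_invariant F \<longleftrightarrow> closedin X F \<and> F \<noteq> {} \<and> \<phi> ` F \<subseteq> F"

text \<open>The multiplier of the \<open>n\<close>-th power: \<open>T^n f\<close> takes the value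
  \<open>wt n k * f ((\<phi> ^^ n) k)\<close> at \<open>k\<close>.\<close>

definition wt :: "nat \<Rightarrow> 'a \<Rightarrow> complex" where
  "wt n k = (\<Prod>i<n. w ((\<phi> ^^ i) k))"

lemma wt_0 [simp]: "wt 0 k = 1"
  by (simp add: wt_def)

lemma wt_Suc: "wt (Suc n) k = wt n k * w ((\<phi> ^^ n) k)"
  by (simp add: wt_def)

lemma wt_Suc_shift: "wt (Suc n) k = w k * wt n (\<phi> k)"
  unfolding wt_def by (subst prod.lessThan_Suc_shift) (simp add: funpow_swap1)

lemma closed_invariantD:
  assumes "closed_invariant F"
  shows "closedin X F" "F \<noteq> {}" "F \<subseteq> topspace X" "\<And>x. x \<in> F \<Longrightarrow> \<phi> x \<in> F"
    "\<And>n x. x \<in> F \<Longrightarrow> (\<phi> ^^ n) x \<in> F"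
proof -
  show 1: "closedin X F" "F \<noteq> {}" "F \<subseteq> topspace X" "\<And>x. x \<in> F \<Longrightarrow> \<phi> x \<in> F"
    using assms by (auto simp: closed_invariant_def dest: closedin_subset)
  show "(\<phi> ^^ n) x \<in> F" if "x \<in> F" for n x
    by (induction n) (use that 1 in auto)
qed

lemma \<phi>_in: "x \<in> topspace X \<Longrightarrow> \<phi> x \<in> topspace X"
  using cont_\<phi> by (auto simp: continuous_map_def)

lemma funpow_in: "x \<in> topspace X \<Longrightarrow> (\<phi> ^^ n) x \<in> topspace X"
  by (induction n) (auto simp: \<phi>_in)

lemma cont_funpow: "continuous_map X X (\<phi> ^^ n)"
  by (induction n) (auto simp: id_def intro: continuous_map_compose[OF _ cont_\<phi>, unfolded o_def] simp: o_def)

lemma cont_compose_funpow: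
  assumes "closed_invariant F" "f \<in> C_space X F"
  shows "continuous_map (subtopology X F) euclidean (\<lambda>x. f ((\<phi> ^^ n) x))"
proof -
  have "continuous_map (subtopology X F) (subtopology X F) (\<phi> ^^ n)"
    by (intro continuous_map_into_subtopology continuous_map_from_subtopology cont_funpow)
      (use closed_invariantD(5)[OF assms(1)] in auto)
  from continuous_map_compose[OF this C_spaceD(1)[OF assms(2)]] show ?thesis
    by (simp add: o_def)
qed

lemma cont_wt: "continuous_map X euclidean (wt n)"
proof -
  have "continuous_map X euclidean (\<lambda>x. w ((\<phi> ^^ i) x))" for i
    using continuous_map_compose[OF cont_funpow cont_w] by (simp add: o_def)
  then show ?thesis
    unfolding wt_def by (intro continuous_map_complex_prod) auto
qed

lemma resolvent_in_C_space:
  assumes "closed_invariant F" "u \<in> C_space X F"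
  shows "(\<lambda>x. z * u x - weighted_comp F w \<phi> u x) \<in> C_space X F"
proof (intro C_space_diff C_space_scale assms(2))
  have "continuous_map (subtopology X F) euclidean (\<lambda>x. w x * u (\<phi> x))"
    using cont_compose_funpow[OF assms, of 1] cont_w
    by (intro continuous_map_complex_mult) (auto intro: continuous_map_from_subtopology)
  from C_spaceI[OF this] show "weighted_comp F w \<phi> u \<in> C_space X F"
    by (simp add: weighted_comp_def)
qed

subsection \<open>Pointwise criteria for the resolvent set\<close>

text \<open>A trivial kernel makes solutions unique, so solutions picked by choice depend linearly
  on the right-hand side. The uniform constant \<open>B\<close> then makes this inverse
  bounded.\<close>

lemma not_in_spectrumI:
  assumes F: "closed_invariant F"
    and surj: "\<And>f. f \<in> C_space X F \<Longrightarrow> \<exists>u\<in>C_space X F.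
      (\<forall>x\<in>F. z * u x - w x * u (\<phi> x) = f x) \<and> (\<forall>x\<in>F. cmod (u x) \<le> B * sup_norm F f)"
    and ker: "\<And>u x. u \<in> C_space X F \<Longrightarrow> (\<And>x. x \<in> F \<Longrightarrow> z * u x = w x * u (\<phi> x)) \<Longrightarrow> x \<in> F \<Longrightarrow> u x = 0"
  shows "z \<notin> spectrum X F (weighted_comp F w \<phi>)"
proof -
  define A where "A = (\<lambda>f x. z * f x - weighted_comp F w \<phi> f x)"
  define P where "P f u \<longleftrightarrow> u \<in> C_space X F \<and>
      (\<forall>x\<in>F. z * u x - w x * u (\<phi> x) = f x) \<and> (\<forall>x\<in>F. cmod (u x) \<le> B * sup_norm F f)" for f u
  define S where "S f = (SOME u. P f u)" for f
  have S: "P f (S f)" if "f \<in> C_space X F" for f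
  proof -
    have "\<exists>u. P f u"
      using surj[OF that] unfolding P_def by blast
    then show ?thesis
      unfolding S_def by (rule someI_ex)
  qed
  have SC: "S f \<in> C_space X F" and Seq: "\<And>x. x \<in> F \<Longrightarrow> z * S f x - w x * S f (\<phi> x) = f x"
    and Sle: "\<And>x. x \<in> F \<Longrightarrow> cmod (S f x) \<le> B * sup_norm F f" if "f \<in> C_space X F" for f
    using S[OF that] by (auto simp: P_def)
  \<comment> \<open>The difference of two solutions lies in the kernel; off \<open>F\<close> both
    representatives are 0.\<close>
  have unique: "u = v" if "u \<in> C_space X F" "v \<in> C_space X F"
    "\<And>x. x \<in> F \<Longrightarrow> z * u x - w x * u (\<phi> x) = z * v x - w x * v (\<phi> x)" for u v
  proof
    fix x
    show "u x = v x"
    proof (cases "x \<in> F")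
      case True
      have "z * (u y - v y) = w y * (u (\<phi> y) - v (\<phi> y))" if "y \<in> F" for y
        using \<open>\<And>x. x \<in> F \<Longrightarrow> z * u x - w x * u (\<phi> x) = z * v x - w x * v (\<phi> x)\<close>[OF that]
        by (simp add: algebra_simps)
      with ker[OF C_space_diff[OF that(1,2)] _ True] show ?thesis by simp
    qed (use that C_spaceD(2) in metis)
  qed
  have "bounded_operator X F S"
    unfolding bounded_operator_def
  proof (intro conjI ballI allI exI)
    fix f g c assume f: "f \<in> C_space X F" and g: "g \<in> C_space X F"
    show "S f \<in> C_space X F" using SC f by auto
    show "S (\<lambda>x. f x + g x) = (\<lambda>x. S f x + S g x)"
    proof (rule unique)
      fix x assume "x \<in> F"
      then show "z * S (\<lambda>x. f x + g x) x - w x * S (\<lambda>x. f x + g x) (\<phi> x) =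
         z * (S f x + S g x) - w x * (S f (\<phi> x) + S g (\<phi> x))"
        using Seq[OF C_space_add[OF f g], of x] Seq[OF f, of x] Seq[OF g, of x]
        by (simp add: algebra_simps)
    qed (intro SC C_space_add f g)+
  next
    fix f c assume f: "f \<in> C_space X F"
    show "S (\<lambda>x. c * f x) = (\<lambda>x. c * S f x)"
    proof (rule unique)
      fix x assume "x \<in> F"
      then have "z * (c * S f x) - w x * (c * S f (\<phi> x)) = c * f x"
        using Seq[OF f, of x] by (metis (no_types) mult.left_commute right_diff_distrib)
      with \<open>x \<in> F\<close> show "z * S (\<lambda>x. c * f x) x - w x * S (\<lambda>x. c * f x) (\<phi> x) =
         z * (c * S f x) - w x * (c * S f (\<phi> x))"
        using Seq[OF C_space_scale[OF f], of x c] by simp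
    qed (intro SC C_space_scale f)+
  next
    fix f assume f: "f \<in> C_space X F"
    show "sup_norm F (S f) \<le> B * sup_norm F f"
      using Sle[OF f] closed_invariantD(2)[OF F] by (rule sup_norm_le[rotated])
  qed
  moreover have "S (A f) = f" "A (S f) = f" if f: "f \<in> C_space X F" for f
  proof -
    have AC: "A f \<in> C_space X F"
      unfolding A_def by (rule resolvent_in_C_space[OF F f])
    show "S (A f) = f"
      using Seq[OF AC] by (intro unique SC AC f) (simp add: A_def weighted_comp_def)
    show "A (S f) = f"
      using Seq[OF f] C_spaceD(2)[OF f] C_spaceD(2)[OF SC[OF f]] by (auto simp: A_def weighted_comp_def)
  qed
  ultimately have "invertible_operator X F A"
    unfolding invertible_operator_def by blast
  then show ?thesis
    by (simp add: spectrum_def A_def)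
qed

text \<open>The lower estimate takes a pointwise bound \<open>b\<close> of \<open>z u - T u\<close>,
  so that it can be fed with perturbation estimates; \<open>b = 0\<close> gives injectivity.\<close>

lemma not_in_spectrumD:
  assumes F: "closed_invariant F" and z: "z \<notin> spectrum X F (weighted_comp F w \<phi>)"
  obtains B where "0 \<le> B"
    "\<And>u b x. u \<in> C_space X F \<Longrightarrow> (\<And>x. x \<in> F \<Longrightarrow> cmod (z * u x - w x * u (\<phi> x)) \<le> b) \<Longrightarrow> x \<in> F
      \<Longrightarrow> cmod (u x) \<le> B * b"
    "\<And>f. f \<in> C_space X F \<Longrightarrow> \<exists>u\<in>C_space X F. \<forall>x\<in>F. z * u x - w x * u (\<phi> x) = f x"
proof -
  define A where "A = (\<lambda>f x. z * f x - weighted_comp F w \<phi> f x)"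
  have A: "A u x = z * u x - w x * u (\<phi> x)" if "x \<in> F" for u x
    using that by (simp add: A_def weighted_comp_def)
  have AC: "A f \<in> C_space X F" if "f \<in> C_space X F" for f
    unfolding A_def by (rule resolvent_in_C_space[OF F that])
  from z obtain S where S: "bounded_operator X F S" "\<And>f. f \<in> C_space X F \<Longrightarrow> S (A f) = f \<and> A (S f) = f"
    unfolding spectrum_def invertible_operator_def A_def by auto
  from S(1) obtain B where B: "\<And>f. f \<in> C_space X F \<Longrightarrow> sup_norm F (S f) \<le> B * sup_norm F f"
    and SC: "\<And>f. f \<in> C_space X F \<Longrightarrow> S f \<in> C_space X F"
    unfolding bounded_operator_def by metis
  note nonneg = sup_norm_nonneg[OF compact closed_invariantD(1)[OF F] _ closed_invariantD(2)[OF F]]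
  show ?thesis
  proof
    \<comment> \<open>The constant in \<open>bounded_operator\<close> carries no sign, hence the
      absolute value.\<close>
    show "0 \<le> \<bar>B\<bar>" by simp
    show "\<exists>u\<in>C_space X F. \<forall>x\<in>F. z * u x - w x * u (\<phi> x) = f x" if "f \<in> C_space X F" for f
      using S(2)[OF that] SC[OF that] A[of _ "S f"] by (intro bexI[of _ "S f"] ballI; metis)
    show "cmod (u x) \<le> \<bar>B\<bar> * b" if u: "u \<in> C_space X F"
      and b: "\<And>x. x \<in> F \<Longrightarrow> cmod (z * u x - w x * u (\<phi> x)) \<le> b" and x: "x \<in> F" for u b x
    proof -
      have "cmod (u x) \<le> sup_norm F (S (A u))"
        using norm_le_sup_norm[OF compact closed_invariantD(1)[OF F] u x] S(2)[OF u] by simp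
      also have "\<dots> \<le> B * sup_norm F (A u)"
        by (intro B AC u)
      also have "\<dots> \<le> \<bar>B\<bar> * sup_norm F (A u)"
        by (intro mult_right_mono nonneg AC u) auto
      also have "sup_norm F (A u) \<le> b"
        using b by (intro sup_norm_le closed_invariantD(2)[OF F]) (simp add: A)
      finally show ?thesis
        by (simp add: mult_left_mono)
    qed
  qed
qed

text \<open>Iterating the equation gives \<open>z ^ n * d x = wt n x * d ((\<phi> ^^ n) x)\<close>,
  so \<open>d x\<close> is bounded by a multiple of \<open>(q / cmod z) ^ n\<close>, which tends to
  0. The set \<open>E\<close> is an arbitrary invariant one so as to include
  \<open>outer \<inter> core\<close>.\<close>

lemma decay_imp_zero:
  assumes inv: "\<And>x. x \<in> E \<Longrightarrow> \<phi> x \<in> E"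
    and decay: "\<And>n k. k \<in> E \<Longrightarrow> cmod (wt n k) \<le> D * q ^ n" and q: "0 \<le> q" "q < cmod z"
    and d: "\<And>x. x \<in> E \<Longrightarrow> z * d x = w x * d (\<phi> x)" and bound: "\<And>x. x \<in> E \<Longrightarrow> cmod (d x) \<le> b"
    and x: "x \<in> E"
  shows "d x = 0"
proof -
  have z: "cmod z > 0" using q by linarith
  have in_E: "(\<phi> ^^ n) x \<in> E" for n
    by (induction n) (use inv x in auto)
  have iter: "z ^ n * d x = wt n x * d ((\<phi> ^^ n) x)" for n
  proof (induction n)
    case (Suc n)
    have "z ^ Suc n * d x = wt n x * (z * d ((\<phi> ^^ n) x))"
      using Suc by (simp add: algebra_simps)
    then show ?case
      using d[OF in_E[of n]] by (simp add: wt_Suc algebra_simps)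
  qed simp
  have "cmod (d x) \<le> D * b * (q / cmod z) ^ n" for n
  proof -
    have "cmod z ^ n * cmod (d x) = cmod (wt n x) * cmod (d ((\<phi> ^^ n) x))"
      using arg_cong[OF iter[of n], of cmod] by (simp add: norm_mult norm_power)
    \<comment> \<open>No sign of \<open>D\<close> is assumed; \<open>D * q ^ n\<close> is
      nonnegative because it bounds a norm.\<close>
    also have "\<dots> \<le> (D * q ^ n) * b"
      using order_trans[OF norm_ge_zero decay[OF x]] by (intro mult_mono decay bound in_E x) auto
    finally show ?thesis
      using z by (simp add: power_divide pos_le_divide_eq mult_ac)
  qed
  moreover have "(\<lambda>n. D * b * (q / cmod z) ^ n) \<longlonglongrightarrow> D * b * 0"
    by (intro tendsto_mult_left LIMSEQ_power_zero) (use q z in auto)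
  ultimately have "cmod (d x) \<le> 0"
    using LIMSEQ_le_const[of "\<lambda>n. D * b * (q / cmod z) ^ n" "D * b * 0" "cmod (d x)"] by auto
  then show ?thesis by simp
qed

text \<open>The terms \<open>T^n f / z^(n+1)\<close> of the Neumann series are dominated by a
  geometric series, so the sum is continuous and \<open>suminf c\<close> bounds the inverse. The
  kernel is trivial by \<open>decay_imp_zero\<close>.\<close>

lemma decay_imp_not_in_spectrum:
  assumes F: "closed_invariant F" and q: "0 \<le> q" "q < cmod z"
    and decay: "\<And>n k. k \<in> F \<Longrightarrow> cmod (wt n k) \<le> D * q ^ n"
  shows "z \<notin> spectrum X F (weighted_comp F w \<phi>)"
proof (rule not_in_spectrumI[OF F])
  have z: "z \<noteq> 0" "cmod z > 0" using q by auto
  define c where "c n = D * (q / cmod z) ^ n / cmod z" for n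
  have c: "summable c"
    unfolding c_def by (intro summable_divide summable_mult summable_geometric) (use q z in auto)
  fix f assume f: "f \<in> C_space X F"
  define N where "N = sup_norm F f"
  define s where "s n x = wt n x * f ((\<phi> ^^ n) x) / z ^ Suc n" for n x
  define v where "v x = (\<Sum>n. s n x)" for x
  have s_le: "cmod (s n x) \<le> c n * N" if "x \<in> F" for n x
  proof -
    have "cmod (s n x) = cmod (wt n x) * cmod (f ((\<phi> ^^ n) x)) / cmod z ^ Suc n"
      by (simp add: s_def norm_mult norm_divide norm_power)
    also have "\<dots> \<le> (D * q ^ n) * N / cmod z ^ Suc n"
      unfolding N_def
      using norm_le_sup_norm[OF compact closed_invariantD(1)[OF F] f]
        order_trans[OF norm_ge_zero decay[OF that]] closed_invariantD(5)[OF F that]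
      by (intro divide_right_mono mult_mono decay that) auto
    also have "\<dots> = c n * N"
      by (simp add: c_def power_divide)
    finally show ?thesis .
  qed
  have cN: "summable (\<lambda>n. c n * N)"
    using c by (rule summable_mult2)
  have s_summable: "summable (\<lambda>n. s n x)" if "x \<in> F" for x
    using s_le[OF that] cN by (rule summable_comparison_test'[of _ 0, rotated])
  have unif: "uniform_limit F (\<lambda>n x. \<Sum>i<n. s i x) v sequentially"
    unfolding v_def using s_le cN by (rule Weierstrass_m_test)
  have s_cont: "continuous_map (subtopology X F) euclidean (s n)" for n
    unfolding s_def divide_inverse
    by (intro continuous_map_complex_mult continuous_map_from_subtopology[OF cont_wt]
        cont_compose_funpow[OF F f]) auto
  \<comment> \<open>The euclidean topology is written as a metric topology to match the uniform
    limit theorem.\<close>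
  have "continuous_map (subtopology X F) Met_TC.mtopology v"
  proof (rule Met_TC.continuous_map_uniform_limit)
    show "\<forall>\<^sub>F n in sequentially. continuous_map (subtopology X F) Met_TC.mtopology (\<lambda>x. \<Sum>i<n. s i x)"
      using s_cont by (intro always_eventually allI) (auto intro!: continuous_map_sum)
    show "\<forall>\<^sub>F n in sequentially. \<forall>x\<in>topspace (subtopology X F).
        v x \<in> UNIV \<and> dist (\<Sum>i<n. s i x) (v x) < e" if "0 < e" for e
      using uniform_limitD[OF unif that] by (rule eventually_mono) auto
  qed simp
  then have "continuous_map (subtopology X F) euclidean v"
    by simp
  from C_spaceI[OF this]
  show "\<exists>u\<in>C_space X F. (\<forall>x\<in>F. z * u x - w x * u (\<phi> x) = f x) \<and>
      (\<forall>x\<in>F. cmod (u x) \<le> suminf c * sup_norm F f)"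
  proof (rule bexI[rotated], intro conjI ballI)
    fix x assume x: "x \<in> F"
    then have \<phi>x: "\<phi> x \<in> F" using closed_invariantD[OF F] by auto
    \<comment> \<open>Shifting the index amounts to applying \<open>T / z\<close>, whence
      \<open>v = f / z + T v / z\<close>.\<close>
    have "s (Suc n) x = w x / z * s n (\<phi> x)" for n
      by (simp add: s_def wt_Suc_shift funpow_swap1)
    then have "(\<Sum>n. s (Suc n) x) = w x / z * v (\<phi> x)"
      unfolding v_def by (simp only: suminf_mult[OF s_summable[OF \<phi>x]])
    moreover have "v x = s 0 x + (\<Sum>n. s (Suc n) x)"
      unfolding v_def using suminf_split_head[OF s_summable[OF x]] by simp
    ultimately have "v x = f x / z + w x / z * v (\<phi> x)"
      by (simp add: s_def)
    with x \<phi>x z show "z * (if x \<in> F then v x else 0) - w x * (if \<phi> x \<in> F then v (\<phi> x) else 0) = f x"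
      by (simp add: field_simps)
    have "cmod (v x) \<le> (\<Sum>n. c n * N)"
      unfolding v_def using s_le[OF x] cN by (rule norm_suminf_le)
    with x show "cmod (if x \<in> F then v x else 0) \<le> suminf c * sup_norm F f"
      using suminf_mult2[OF c, of N] by (simp add: N_def)
  qed
next
  fix u x
  assume u: "u \<in> C_space X F" and x: "x \<in> F" and "\<And>x. x \<in> F \<Longrightarrow> z * u x = w x * u (\<phi> x)"
  then show "u x = 0"
    using decay_imp_zero[of F D q z u "sup_norm F u"] q decay closed_invariantD[OF F]
      norm_le_sup_norm[OF compact closed_invariantD(1)[OF F] u] by blast
qed

subsection \<open>Growth of the weights along orbits outside the core\<close>

text \<open>Urysohn's lemma for \<open>Z\<close> and the closed singleton of \<open>p\<close>,
  compact Hausdorff spaces being normal.\<close>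

lemma bump:
  assumes "closedin X Z" "p \<in> topspace X" "p \<notin> Z"
  obtains g :: "'a \<Rightarrow> complex" where "continuous_map X euclidean g" "g p = 1"
    "\<And>x. x \<in> Z \<Longrightarrow> g x = 0" "\<And>x. x \<in> topspace X \<Longrightarrow> cmod (g x) \<le> 1"
proof -
  have p: "closedin X {p}"
    using closedin_Hausdorff_finite[OF Hausdorff, of "{p}"] assms(2) by simp
  have normal: "normal_space X"
    using compact_Hausdorff_or_regular_imp_normal_space[OF compact] Hausdorff by simp
  obtain h :: "'a \<Rightarrow> real" where
    h: "continuous_map X (top_of_set {0..1}) h" "h ` Z \<subseteq> {0}" "h ` {p} \<subseteq> {1}"
    using Urysohn_lemma[OF normal assms(1) p, of 0 1] assms(3) by (auto simp: disjnt_def)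
  show ?thesis
  proof
    show "continuous_map X euclidean (\<lambda>x. complex_of_real (h x))"
      using h(1) by (intro continuous_map_complex_of_real) (simp add: continuous_map_in_subtopology)
    show "cmod (complex_of_real (h x)) \<le> 1" if "x \<in> topspace X" for x
      using continuous_map_image_subset_topspace[OF h(1)] that by fastforce
  qed (use h in auto)
qed

section \<open>The set \<open>L\<close> of the theorem: points with preimages of every order\<close>

definition core :: "'a set" where
  "core = (\<Inter>n. (\<phi> ^^ n) ` topspace X)"

lemma closedin_image_funpow: "closedin X ((\<phi> ^^ n) ` topspace X)"
proof (rule compactin_imp_closedin[OF Hausdorff])
  show "compactin X ((\<phi> ^^ n) ` topspace X)"
    using compact cont_funpow by (auto simp: compact_space_def intro: image_compactin)
qed

lemma inj_funpow: "inj_on (\<phi> ^^ n) (topspace X)"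
proof (induction n)
  case (Suc n)
  have "(\<phi> ^^ n) ` topspace X \<subseteq> topspace X"
    by (auto simp: funpow_in)
  then show ?case
    using comp_inj_on[OF Suc inj_on_subset[OF inj_\<phi>]] by (simp add: o_def)
qed simp

lemma decseq_image_funpow: "decseq (\<lambda>n. (\<phi> ^^ n) ` topspace X)"
proof (rule decseq_SucI)
  fix n
  show "(\<phi> ^^ Suc n) ` topspace X \<subseteq> (\<phi> ^^ n) ` topspace X"
    by (simp only: funpow_Suc_right image_comp[symmetric]) (auto simp: \<phi>_in)
qed

lemma closedin_core: "closedin X core"
  unfolding core_def using closedin_image_funpow by (intro closedin_Inter) auto

lemma core_subset: "core \<subseteq> topspace X"
  using closedin_core closedin_subset by blast

lemma core_image:
  assumes "x \<in> core"
  shows "\<phi> x \<in> core"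
  unfolding core_def
proof
  fix n
  show "\<phi> x \<in> (\<phi> ^^ n) ` topspace X"
  proof (cases n)
    case 0
    then show ?thesis using assms core_subset \<phi>_in by auto
  next
    case (Suc m)
    have "x \<in> (\<phi> ^^ m) ` topspace X" using assms by (auto simp: core_def)
    then show ?thesis using Suc by auto
  qed
qed

text \<open>Injectivity cancels one application of \<open>\<phi>\<close>. Consequently an orbit that
  starts off the core never enters it.\<close>

lemma core_preimage:
  assumes "x \<in> topspace X" "\<phi> x \<in> core"
  shows "x \<in> core"
  unfolding core_def
proof
  fix n
  have "\<phi> x \<in> (\<phi> ^^ Suc n) ` topspace X" using assms(2) unfolding core_def by blast
  then obtain y where y: "y \<in> topspace X" "\<phi> x = \<phi> ((\<phi> ^^ n) y)" by auto
  then have "x = (\<phi> ^^ n) y"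
    using inj_\<phi> assms(1) funpow_in by (auto dest: inj_onD)
  with y show "x \<in> (\<phi> ^^ n) ` topspace X" by auto
qed

lemma core_funpow_preimage:
  assumes "x \<in> topspace X" "(\<phi> ^^ n) x \<in> core"
  shows "x \<in> core"
  using assms(2) by (induction n) (use assms(1) core_preimage funpow_in in auto)

text \<open>Cantor's intersection theorem for the decreasing closed images.\<close>

lemma core_nonempty:
  assumes "topspace X \<noteq> {}"
  shows "core \<noteq> {}"
  unfolding core_def
  by (rule compact_space_imp_nest[OF compact closedin_image_funpow _ decseq_image_funpow])
    (use assms in auto)

text \<open>After cancelling by injectivity, a repetition would make \<open>k\<close> periodic, and
  a periodic point lies in the image of every iterate, hence in the core.\<close>

lemma orbit_inj:
  assumes k: "k \<in> topspace X - core" and eq: "(\<phi> ^^ i) k = (\<phi> ^^ j) k"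
  shows "i = j"
proof -
  have "False" if "i < j" and eq: "(\<phi> ^^ i) k = (\<phi> ^^ j) k" for i j
  proof -
    define d where "d = j - i"
    have "(\<phi> ^^ i) k = (\<phi> ^^ i) ((\<phi> ^^ d) k)"
      using eq that(1) funpow_add[of i d \<phi>] by (simp add: d_def)
    then have per: "(\<phi> ^^ d) k = k"
      using inj_funpow[of i] k funpow_in by (auto dest: inj_onD)
    have "k \<in> (\<phi> ^^ n) ` topspace X" for n
    proof -
      \<comment> \<open>This lets \<open>\<phi> ^^ n\<close> be split off from
        \<open>\<phi> ^^ (d * n)\<close>, which fixes \<open>k\<close>.\<close>
      have "n \<le> d * n"
        by (cases d) (use that(1) d_def in auto)
      have "k = ((\<phi> ^^ d) ^^ n) k"
        by (induction n) (auto simp: per)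
      also have "\<dots> = (\<phi> ^^ (n + (d * n - n))) k"
        using \<open>n \<le> d * n\<close> by (simp add: funpow_mult)
      also have "\<dots> = (\<phi> ^^ n) ((\<phi> ^^ (d * n - n)) k)"
        by (simp add: funpow_add)
      finally show ?thesis
        using k funpow_in by blast
    qed
    with k show False by (auto simp: core_def)
  qed
  with eq show ?thesis
    by (metis linorder_neqE_nat)
qed

text \<open>The solution \<open>u\<close> of \<open>(z' - T) u = g\<close> is a finite sum whose
  value at \<open>k\<close> is the single term with \<open>wt i k\<close>. Its norm is at most
  \<open>2 * B\<close>, because \<open>z - z'\<close> is small enough for the perturbation to be
  absorbed.\<close>

lemma resolvent_bound_imp_wt_bound:
  assumes F: "closed_invariant F" "topspace X - core \<subseteq> F" and B: "0 \<le> B" "B * cmod (z - z') \<le> 1 / 2"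
    and z': "z' \<noteq> 0"
    and below: "\<And>u b x. u \<in> C_space X F \<Longrightarrow> (\<And>x. x \<in> F \<Longrightarrow> cmod (z * u x - w x * u (\<phi> x)) \<le> b)
      \<Longrightarrow> x \<in> F \<Longrightarrow> cmod (u x) \<le> B * b"
    and k: "k \<in> topspace X - core"
  shows "cmod (wt i k) \<le> 2 * B * cmod z' ^ Suc i"
proof -
  define p where "p = (\<phi> ^^ i) k"
  have pX: "p \<in> topspace X" using k funpow_in by (auto simp: p_def)
  have "p \<notin> core" using k core_funpow_preimage by (auto simp: p_def)
  \<comment> \<open>The length of the finite sum: \<open>g\<close> can vanish on the
    \<open>m\<close>-th image and still be 1 at \<open>p\<close>.\<close>
  then obtain m where m: "p \<notin> (\<phi> ^^ m) ` topspace X" by (auto simp: core_def)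
  have "i < m"
  proof (rule ccontr)
    assume "\<not> i < m"
    then have "(\<phi> ^^ i) ` topspace X \<subseteq> (\<phi> ^^ m) ` topspace X"
      using decseq_image_funpow by (auto simp: decseq_def)
    with m k show False by (auto simp: p_def)
  qed
  \<comment> \<open>Vanishing on the first set gives \<open>T^m g = 0\<close>; vanishing on the
    second leaves only index \<open>i\<close> in the sum at \<open>k\<close>.\<close>
  define Z where "Z = (\<phi> ^^ m) ` topspace X \<union> (\<lambda>j. (\<phi> ^^ j) k) ` ({..<m} - {i})"
  have "closedin X Z"
    unfolding Z_def using k funpow_in
    by (intro closedin_Un closedin_image_funpow closedin_Hausdorff_finite[OF Hausdorff]) auto
  moreover have "p \<notin> Z"
    using m orbit_inj[OF k] by (auto simp: Z_def p_def)
  ultimately obtain g where g: "continuous_map X euclidean g" "g p = 1"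
    "\<And>x. x \<in> Z \<Longrightarrow> g x = 0" "\<And>x. x \<in> topspace X \<Longrightarrow> cmod (g x) \<le> 1"
    using bump[OF _ pX] by metis
  define v where "v n x = (\<Sum>j<n. wt j x * g ((\<phi> ^^ j) x) / z' ^ Suc j)" for n x
  \<comment> \<open>The truncated Neumann series telescopes up to the remainder
    \<open>T^n g / z'^n\<close>, which is 0 for \<open>n = m\<close>.\<close>
  have v: "z' * v n x - w x * v n (\<phi> x) = g x - wt n x * g ((\<phi> ^^ n) x) / z' ^ n" for n x
  proof (induction n)
    case (Suc n)
    define a where "a = wt n x * g ((\<phi> ^^ n) x)"
    define b where "b = wt n (\<phi> x) * g ((\<phi> ^^ n) (\<phi> x))"
    have b: "w x * b = wt (Suc n) x * g ((\<phi> ^^ Suc n) x)"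
      by (simp add: b_def wt_Suc_shift funpow_swap1)
    have "v (Suc n) x = v n x + a / z' ^ Suc n" "v (Suc n) (\<phi> x) = v n (\<phi> x) + b / z' ^ Suc n"
      by (simp_all add: v_def a_def b_def)
    then have "z' * v (Suc n) x - w x * v (Suc n) (\<phi> x) =
        (z' * v n x - w x * v n (\<phi> x)) + z' * (a / z' ^ Suc n) - w x * b / z' ^ Suc n"
      by (simp only:) (simp only: distrib_left times_divide_eq_right, simp)
    also have "z' * (a / z' ^ Suc n) = a / z' ^ n"
      using z' by simp
    finally show ?case
      by (simp add: Suc b a_def)
  qed (simp add: v_def)
  define u where "u x = (if x \<in> F then v m x else 0)" for x
  have u_eq: "z' * u x - w x * u (\<phi> x) = g x" if "x \<in> F" for x
  proof -
    have "(\<phi> ^^ m) x \<in> Z"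
      using that closedin_subset[OF closed_invariantD(1)[OF F(1)]] by (auto simp: Z_def)
    with v[of m x] that closed_invariantD(4)[OF F(1) that] g(3) show ?thesis
      by (simp add: u_def)
  qed
  have "continuous_map X euclidean (\<lambda>x. g ((\<phi> ^^ j) x))" for j
    using continuous_map_compose[OF cont_funpow g(1)] by (simp add: o_def)
  then have "continuous_map X euclidean (v m)"
    unfolding v_def divide_inverse
    by (intro continuous_map_sum continuous_map_complex_mult cont_wt) auto
  from C_spaceI[OF continuous_map_from_subtopology[OF this]] have uC: "u \<in> C_space X F"
    by (simp add: u_def[abs_def])
  define N where "N = sup_norm F u"
  note u_le = norm_le_sup_norm[OF compact closed_invariantD(1)[OF F(1)] uC, folded N_def]
  have "cmod (z * u x - w x * u (\<phi> x)) \<le> 1 + cmod (z - z') * N" if "x \<in> F" for x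
  proof -
    have "z * u x - w x * u (\<phi> x) = g x + (z - z') * u x"
      using u_eq[OF that] by (simp add: algebra_simps)
    also have "cmod \<dots> \<le> cmod (g x) + cmod (z - z') * cmod (u x)"
      by (metis norm_mult norm_triangle_ineq)
    also have "\<dots> \<le> 1 + cmod (z - z') * N"
      using closed_invariantD(3)[OF F(1)] that by (intro add_mono g(4) mult_left_mono u_le) auto
    finally show ?thesis .
  qed
  from below[OF uC this] have "N \<le> B * (1 + cmod (z - z') * N)"
    unfolding N_def using closed_invariantD(2)[OF F(1)] by (intro sup_norm_le) auto
  also have "\<dots> = B + (B * cmod (z - z')) * N"
    by (simp add: algebra_simps)
  \<comment> \<open>Half of \<open>N\<close> is absorbed into the left-hand side.\<close>
  also have "\<dots> \<le> B + (1 / 2) * N"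
    using sup_norm_nonneg[OF compact closed_invariantD(1)[OF F(1)] uC closed_invariantD(2)[OF F(1)]]
    by (intro add_left_mono mult_right_mono B) (simp add: N_def)
  finally have N: "N \<le> 2 * B" by simp
  have kF: "k \<in> F" using k F(2) by auto
  have "v m k = (\<Sum>j\<in>{i}. wt j k * g ((\<phi> ^^ j) k) / z' ^ Suc j)"
    unfolding v_def using \<open>i < m\<close> g(3) by (intro sum.mono_neutral_right) (auto simp: Z_def)
  then have "u k = wt i k / z' ^ Suc i"
    using kF g(2) by (simp add: u_def p_def)
  then have "cmod (wt i k) / cmod z' ^ Suc i \<le> 2 * B"
    using u_le[OF kF] N by (simp add: norm_divide norm_mult norm_power)
  then show ?thesis
    using z' by (simp add: divide_le_eq)
qed

section \<open>The set \<open>M\<close> of the theorem and the decay of the weights on it\<close>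

definition outer :: "'a set" where
  "outer = topspace X - X interior_of core"

text \<open>In this form, closed conditions pass from the complement of the core to all of
  \<open>outer\<close>.\<close>

lemma outer_eq_closure: "outer = X closure_of (topspace X - core)"
  by (simp add: outer_def closure_of_complement)

lemma noncore_subset_outer: "topspace X - core \<subseteq> outer"
  by (simp add: outer_eq_closure closure_of_subset)

text \<open>A point missed by \<open>\<phi>\<close> is off the core, since the core lies in the
  first image.\<close>

lemma obtain_not_in_image:
  obtains e where "e \<in> topspace X - core" "e \<notin> \<phi> ` topspace X"
proof -
  obtain e where e: "e \<in> topspace X" "e \<notin> \<phi> ` topspace X"
    using not_surj by blast
  moreover have "core \<subseteq> (\<phi> ^^ 1) ` topspace X"
    unfolding core_def by blast
  ultimately show ?thesis
    using that by auto
qed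

lemma closed_invariant_topspace: "closed_invariant (topspace X)"
  using not_surj unfolding closed_invariant_def by auto

lemma closed_invariant_core: "closed_invariant core"
  using closedin_core core_nonempty[OF closed_invariantD(2)[OF closed_invariant_topspace]] core_image
  unfolding closed_invariant_def by blast

text \<open>The preimage of the interior of the core is open and, by \<open>core_preimage\<close>,
  inside the core, so it lies in that interior. Hence no point of \<open>outer\<close> is mapped
  into it.\<close>

lemma closed_invariant_outer: "closed_invariant outer"
proof -
  have "\<phi> x \<notin> X interior_of core" if x: "x \<in> topspace X" "x \<notin> X interior_of core" for x
  proof
    assume "\<phi> x \<in> X interior_of core"
    moreover have "openin X {y \<in> topspace X. \<phi> y \<in> X interior_of core}"
      using cont_\<phi> openin_interior_of by (rule openin_continuous_map_preimage)
    moreover have "{y \<in> topspace X. \<phi> y \<in> X interior_of core} \<subseteq> core"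
      using core_preimage interior_of_subset by fast
    ultimately show False
      using x interior_of_maximal by fastforce
  qed
  moreover have "outer \<noteq> {}"
    using obtain_not_in_image noncore_subset_outer by (metis empty_iff subsetD)
  moreover have "closedin X outer"
    by (simp add: outer_eq_closure)
  ultimately show ?thesis
    unfolding closed_invariant_def by (auto simp: outer_def \<phi>_in)
qed

text \<open>Moving \<open>z\<close> slightly towards 0 keeps the resolvent estimate usable and
  yields a rate strictly below \<open>cmod z\<close>. The set \<open>F\<close> is left general to
  serve both \<open>outer\<close> and the whole space.\<close>

lemma resolvent_imp_decay:
  assumes F: "closed_invariant F" "topspace X - core \<subseteq> F"
    and z: "z \<noteq> 0" "z \<notin> spectrum X F (weighted_comp F w \<phi>)"
  obtains D q where "0 \<le> q" "q < cmod z" "\<And>n k. k \<in> outer \<Longrightarrow> cmod (wt n k) \<le> D * q ^ n"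
proof -
  obtain B where B: "0 \<le> B" and below: "\<And>u b x. u \<in> C_space X F \<Longrightarrow>
      (\<And>x. x \<in> F \<Longrightarrow> cmod (z * u x - w x * u (\<phi> x)) \<le> b) \<Longrightarrow> x \<in> F \<Longrightarrow> cmod (u x) \<le> B * b"
    using not_in_spectrumD[OF F(1) z(2)] by metis
  define s where "s = B * cmod z"
  \<comment> \<open>Chosen so that \<open>t * s \<le> 1 / 2\<close>; the summand 1 keeps
    \<open>t\<close> defined and below 1 when \<open>s = 0\<close>.\<close>
  define t where "t = 1 / (2 * (1 + s))"
  define z' where "z' = of_real (1 - t) * z"
  have "0 \<le> s"
    using B by (simp add: s_def)
  then have t: "0 < t" "t < 1" "t * s \<le> 1 / 2"
    by (simp_all add: t_def field_simps)
  have "z - z' = of_real t * z"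
    by (simp add: z'_def algebra_simps)
  then have close: "B * cmod (z - z') \<le> 1 / 2"
    using t by (simp add: norm_mult s_def mult_ac)
  have norm_z': "cmod z' = (1 - t) * cmod z"
    using t unfolding z'_def norm_mult norm_of_real by simp
  have "z' \<noteq> 0" "cmod z' < cmod z"
    using t z(1) norm_z' by (auto simp: z'_def)
  show ?thesis
  proof
    show "0 \<le> cmod z'" by simp
    show "cmod z' < cmod z" by fact
    fix n k assume k: "k \<in> outer"
    have "cmod (wt n x) \<le> 2 * B * cmod z' ^ Suc n" if "x \<in> topspace X - core" for x
      by (rule resolvent_bound_imp_wt_bound[OF F B close \<open>z' \<noteq> 0\<close> _ that]) (rule below)
    \<comment> \<open>The bound defines a closed set, so it extends to the closure
      \<open>outer\<close>.\<close>
    then have "topspace X - core \<subseteq> {k \<in> topspace X. wt n k \<in> cball 0 (2 * B * cmod z' ^ Suc n)}"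
      by auto
    moreover have "closedin X {k \<in> topspace X. wt n k \<in> cball 0 (2 * B * cmod z' ^ Suc n)}"
      using cont_wt by (rule closedin_continuous_map_preimage) simp
    ultimately have "outer \<subseteq> {k \<in> topspace X. wt n k \<in> cball 0 (2 * B * cmod z' ^ Suc n)}"
      unfolding outer_eq_closure by (rule closure_of_minimal)
    with k show "cmod (wt n k) \<le> (2 * B * cmod z') * cmod z' ^ n"
      by auto
  qed
qed

section \<open>The spectrum on \<open>C(M)\<close> is a disc\<close>

lemma zero_in_spectrum:
  assumes F: "closed_invariant F" "topspace X - core \<subseteq> F"
  shows "0 \<in> spectrum X F (weighted_comp F w \<phi>)"
proof (rule ccontr)
  assume "0 \<notin> spectrum X F (weighted_comp F w \<phi>)"
  then obtain B where below: "\<And>u b x. u \<in> C_space X F \<Longrightarrow>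
      (\<And>x. x \<in> F \<Longrightarrow> cmod (0 * u x - w x * u (\<phi> x)) \<le> b) \<Longrightarrow> x \<in> F \<Longrightarrow> cmod (u x) \<le> B * b"
    using not_in_spectrumD[OF F(1)] by metis
  obtain e where e: "e \<in> topspace X - core" "e \<notin> \<phi> ` topspace X"
    by (rule obtain_not_in_image)
  obtain g :: "'a \<Rightarrow> complex" where g: "continuous_map X euclidean g" "g e = 1"
    "\<And>x. x \<in> \<phi> ` topspace X \<Longrightarrow> g x = 0" "\<And>x. x \<in> topspace X \<Longrightarrow> cmod (g x) \<le> 1"
  proof (rule bump)
    show "closedin X (\<phi> ` topspace X)"
      using closedin_image_funpow[of 1] by simp
  qed (use e in auto)
  \<comment> \<open>A kernel element of \<open>T\<close>: it vanishes on the image of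
    \<open>\<phi>\<close> but equals 1 at \<open>e\<close>.\<close>
  define u where "u x = (if x \<in> F then g x else 0)" for x
  have "u \<in> C_space X F"
    unfolding u_def[abs_def] using g(1) by (intro C_spaceI continuous_map_from_subtopology)
  moreover have "u (\<phi> x) = 0" if "x \<in> F" for x
    using that closed_invariantD(3)[OF F(1)] g(3) by (auto simp: u_def)
  ultimately have "cmod (u e) \<le> B * 0"
    using e F(2) by (intro below) auto
  with e F(2) g(2) show False
    by (auto simp: u_def)
qed

text \<open>Invertibility at \<open>z\<close> gives decay at a rate \<open>q\<close> below
  \<open>cmod z\<close>, and decay makes every point of modulus above \<open>q\<close> a resolvent
  point.\<close>

lemma spectrum_outer_downward:
  assumes z: "z \<notin> spectrum X outer (weighted_comp outer w \<phi>)"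
  obtains q where "0 \<le> q" "q < cmod z" "spectrum X outer (weighted_comp outer w \<phi>) \<subseteq> cball 0 q"
proof -
  have "z \<noteq> 0"
    using z zero_in_spectrum[OF closed_invariant_outer noncore_subset_outer] by metis
  then obtain D q where q: "0 \<le> q" "q < cmod z"
    and decay: "\<And>n k. k \<in> outer \<Longrightarrow> cmod (wt n k) \<le> D * q ^ n"
    using resolvent_imp_decay[OF closed_invariant_outer noncore_subset_outer _ z] by metis
  have "cmod c \<le> q" if "c \<in> spectrum X outer (weighted_comp outer w \<phi>)" for c
    using decay_imp_not_in_spectrum[OF closed_invariant_outer q(1) _ decay] that by force
  then have "spectrum X outer (weighted_comp outer w \<phi>) \<subseteq> cball 0 q"
    by auto
  with q show ?thesis
    by (rule that)
qed

text \<open>A bound \<open>W\<close> of the weight gives \<open>cmod (wt n k) \<le> W ^ n\<close>.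
  Boundedness makes the supremum in \<open>spectral_radius\<close> a genuine one.\<close>

lemma spectrum_bounded:
  assumes F: "closed_invariant F"
  shows "bounded (spectrum X F (weighted_comp F w \<phi>))"
proof -
  have "compactin X (topspace X)" using compact by (simp add: compact_space_def)
  from image_compactin[OF this cont_w] have "compact (w ` topspace X)" by simp
  then obtain W where W: "\<And>x. x \<in> topspace X \<Longrightarrow> cmod (w x) \<le> W" "0 < W"
    using compact_imp_bounded bounded_pos by (metis imageI)
  have decay: "cmod (wt n k) \<le> 1 * W ^ n" if "k \<in> F" for n k
  proof -
    have "(\<phi> ^^ i) k \<in> topspace X" for i
      using closed_invariantD(3)[OF F] that funpow_in by blast
    then have "(\<Prod>i<n. cmod (w ((\<phi> ^^ i) k))) \<le> (\<Prod>i<n. W)"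
      using W(1) by (intro prod_mono) auto
    then show ?thesis
      by (simp add: wt_def prod_norm[symmetric])
  qed
  have "cmod c \<le> W" if "c \<in> spectrum X F (weighted_comp F w \<phi>)" for c
    using decay_imp_not_in_spectrum[OF F _ _ decay] W(2) that by force
  then show ?thesis
    by (auto simp: bounded_iff)
qed

text \<open>A point \<open>c\<close> of the disc missing from the spectrum would confine the
  spectrum to a radius below \<open>cmod c\<close>, against the definition of the spectral radius.
  For radius 0 the disc is the singleton of 0.\<close>

lemma spectrum_outer_eq_disc:
  "spectrum X outer (weighted_comp outer w \<phi>) =
    (\<lambda>z. complex_of_real (spectral_radius X outer (weighted_comp outer w \<phi>)) * z) ` cball 0 1"
proof -
  define S where "S = spectrum X outer (weighted_comp outer w \<phi>)"
  define r where "r = spectral_radius X outer (weighted_comp outer w \<phi>)"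
  have S0: "0 \<in> S"
    unfolding S_def by (rule zero_in_spectrum[OF closed_invariant_outer noncore_subset_outer])
  have "bdd_above (cmod ` S)"
    using spectrum_bounded[OF closed_invariant_outer] by (auto simp: S_def bounded_iff bdd_above_def)
  then have r_ge: "cmod c \<le> r" if "c \<in> S" for c
    unfolding r_def spectral_radius_def S_def[symmetric] using that by (rule cSUP_upper2) simp
  have r_le: "r \<le> b" if "\<And>c. c \<in> S \<Longrightarrow> cmod c \<le> b" for b
    unfolding r_def spectral_radius_def S_def[symmetric] using S0 that by (intro cSUP_least) auto
  have "0 \<le> r" using r_ge[OF S0] by simp
  have "S = cball 0 r"
  proof (intro subset_antisym subsetI)
    show "c \<in> cball 0 r" if "c \<in> S" for c
      using r_ge that by simp
    show "c \<in> S" if c: "c \<in> cball 0 r" for c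
    proof (rule ccontr)
      assume "c \<notin> S"
      then obtain q where q: "q < cmod c" "S \<subseteq> cball 0 q"
        using spectrum_outer_downward unfolding S_def by metis
      then have "r \<le> q"
        by (intro r_le) (auto dest: subsetD)
      with q c show False by simp
    qed
  qed
  also have "\<dots> = (\<lambda>z. of_real r * z) ` cball 0 1"
    using cball_scale[of r "0 :: complex" 1] \<open>0 \<le> r\<close>
    by (cases "r = 0") (auto simp: scaleR_conv_of_real[abs_def] image_constant_conv)
  finally show ?thesis
    by (simp add: S_def r_def)
qed

subsection \<open>Gluing and extension\<close>

text \<open>Tietze extension of the real and imaginary parts separately, which costs the factor
  2.\<close>

lemma C_space_extension:
  assumes F: "closedin X F" "F \<noteq> {}" and f: "f \<in> C_space X F"
  obtains g where "g \<in> C_space X (topspace X)" "\<And>x. x \<in> F \<Longrightarrow> g x = f x"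
    "\<And>x. x \<in> topspace X \<Longrightarrow> cmod (g x) \<le> 2 * sup_norm F f"
proof -
  define N where "N = sup_norm F f"
  note f_le = norm_le_sup_norm[OF compact F(1) f, folded N_def]
  have "0 \<le> N"
    unfolding N_def by (rule sup_norm_nonneg[OF compact F(1) f F(2)])
  have normal: "normal_space X"
    using compact_Hausdorff_or_regular_imp_normal_space[OF compact] Hausdorff by simp
  have Re: "continuous_map (subtopology X F) euclideanreal (\<lambda>x. Re (f x))"
    and Im: "continuous_map (subtopology X F) euclideanreal (\<lambda>x. Im (f x))"
    using C_spaceD(1)[OF f] by (simp_all add: continuous_map_atin tendsto_Re tendsto_Im)
  obtain a where a: "continuous_map X euclideanreal a" "\<And>x. x \<in> F \<Longrightarrow> a x = Re (f x)"
    "a ` topspace X \<subseteq> {-N..N}"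
  proof (rule Tietze_extension_closed_real_interval[OF normal F(1) Re, of "-N" N])
    have "\<bar>Re (f x)\<bar> \<le> N" if "x \<in> F" for x
      using f_le[OF that] abs_Re_le_cmod[of "f x"] by linarith
    then show "(\<lambda>x. Re (f x)) ` F \<subseteq> {-N..N}"
      by (auto simp: abs_le_iff minus_le_iff)
  qed (use \<open>0 \<le> N\<close> in auto)
  obtain b where b: "continuous_map X euclideanreal b" "\<And>x. x \<in> F \<Longrightarrow> b x = Im (f x)"
    "b ` topspace X \<subseteq> {-N..N}"
  proof (rule Tietze_extension_closed_real_interval[OF normal F(1) Im, of "-N" N])
    have "\<bar>Im (f x)\<bar> \<le> N" if "x \<in> F" for x
      using f_le[OF that] abs_Im_le_cmod[of "f x"] by linarith
    then show "(\<lambda>x. Im (f x)) ` F \<subseteq> {-N..N}"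
      by (auto simp: abs_le_iff minus_le_iff)
  qed (use \<open>0 \<le> N\<close> in auto)
  define h where "h x = complex_of_real (a x) + \<i> * complex_of_real (b x)" for x
  have "continuous_map X euclidean h"
    unfolding h_def using a(1) b(1)
    by (intro continuous_map_add continuous_map_complex_mult continuous_map_complex_of_real) auto
  then have "(\<lambda>x. if x \<in> topspace X then h x else 0) \<in> C_space X (topspace X)"
    by (intro C_spaceI) simp
  then show ?thesis
  proof (rule that)
    show "(if x \<in> topspace X then h x else 0) = f x" if "x \<in> F" for x
      using that closedin_subset[OF F(1)] a(2) b(2) by (auto simp: h_def complex_eq_iff)
    show "cmod (if x \<in> topspace X then h x else 0) \<le> 2 * sup_norm F f" if "x \<in> topspace X" for x
    proof -
      have "cmod (h x) \<le> \<bar>a x\<bar> + \<bar>b x\<bar>"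
        using norm_triangle_ineq[of "complex_of_real (a x)" "\<i> * complex_of_real (b x)"]
        by (simp add: h_def norm_mult)
      also have "\<dots> \<le> N + N"
        using a(3) b(3) that by (intro add_mono) (auto simp: abs_le_iff image_subset_iff)
      finally show ?thesis using that by (simp add: N_def)
    qed
  qed
qed

text \<open>Pasting over two closed sets that cover the space, indexed by the booleans.\<close>

lemma C_space_glue:
  assumes u: "u \<in> C_space X outer" and v: "v \<in> C_space X core"
    and eq: "\<And>x. x \<in> outer \<Longrightarrow> x \<in> core \<Longrightarrow> u x = v x"
  shows "(\<lambda>x. if x \<in> outer then u x else v x) \<in> C_space X (topspace X)"
proof -
  have "continuous_map X euclidean (\<lambda>x. if x \<in> outer then u x else v x)"
  proof (rule pasting_lemma_closed[where I = UNIV and T = "\<lambda>b. if b then outer else core"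
        and f = "\<lambda>b. if b then u else v"])
    show "closedin X (if b then outer else core)" for b
      using closed_invariantD(1) closed_invariant_outer closed_invariant_core by simp
    show "continuous_map (subtopology X (if b then outer else core)) euclidean (if b then u else v)" for b
      using C_spaceD(1)[OF u] C_spaceD(1)[OF v] by simp
    show "\<exists>j. j \<in> UNIV \<and> x \<in> (if j then outer else core) \<and>
        (if x \<in> outer then u x else v x) = (if j then u else v) x" if "x \<in> topspace X" for x
      using that noncore_subset_outer by (intro exI[of _ "x \<in> outer"]) auto
  qed (use eq in \<open>auto split: if_splits\<close>)
  then show ?thesis
    using C_spaceD(2)[OF u] C_spaceD(2)[OF v]
      closed_invariantD(3)[OF closed_invariant_outer] core_subset
    by (auto simp: C_space_def)
qed

text \<open>The equation is solved separately on \<open>outer\<close> and \<open>core\<close>. On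
  the overlap the difference of the solutions satisfies \<open>z d = T d\<close> and vanishes by
  decay, so they glue.\<close>

lemma not_in_spectrum_topspaceI:
  assumes zM: "z \<notin> spectrum X outer (weighted_comp outer w \<phi>)"
    and zL: "z \<notin> spectrum X core (weighted_comp core w \<phi>)"
  shows "z \<notin> spectrum X (topspace X) (weighted_comp (topspace X) w \<phi>)"
proof -
  note invM = closed_invariantD[OF closed_invariant_outer]
    and invL = closed_invariantD[OF closed_invariant_core]
    and invK = closed_invariantD[OF closed_invariant_topspace]
  have "z \<noteq> 0"
    using zM zero_in_spectrum[OF closed_invariant_outer noncore_subset_outer] by metis
  then obtain D q where q: "0 \<le> q" "q < cmod z"
    and decay: "\<And>n k. k \<in> outer \<Longrightarrow> cmod (wt n k) \<le> D * q ^ n"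
    using resolvent_imp_decay[OF closed_invariant_outer noncore_subset_outer _ zM] by metis
  obtain BM where BM: "0 \<le> BM" "\<And>u b x. u \<in> C_space X outer \<Longrightarrow>
      (\<And>x. x \<in> outer \<Longrightarrow> cmod (z * u x - w x * u (\<phi> x)) \<le> b) \<Longrightarrow> x \<in> outer \<Longrightarrow> cmod (u x) \<le> BM * b"
    "\<And>f. f \<in> C_space X outer \<Longrightarrow> \<exists>u\<in>C_space X outer. \<forall>x\<in>outer. z * u x - w x * u (\<phi> x) = f x"
    using not_in_spectrumD[OF closed_invariant_outer zM] by metis
  obtain BL where BL: "0 \<le> BL" "\<And>u b x. u \<in> C_space X core \<Longrightarrow>
      (\<And>x. x \<in> core \<Longrightarrow> cmod (z * u x - w x * u (\<phi> x)) \<le> b) \<Longrightarrow> x \<in> core \<Longrightarrow> cmod (u x) \<le> BL * b"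
    "\<And>f. f \<in> C_space X core \<Longrightarrow> \<exists>u\<in>C_space X core. \<forall>x\<in>core. z * u x - w x * u (\<phi> x) = f x"
    using not_in_spectrumD[OF closed_invariant_core zL] by metis
  show ?thesis
  proof (rule not_in_spectrumI[OF closed_invariant_topspace])
    fix f assume f: "f \<in> C_space X (topspace X)"
    define N where "N = sup_norm (topspace X) f"
    note f_le = norm_le_sup_norm[OF compact invK(1) f, folded N_def]
    have "0 \<le> N"
      unfolding N_def by (rule sup_norm_nonneg[OF compact invK(1) f invK(2)])
    obtain u where u: "u \<in> C_space X outer" "\<And>x. x \<in> outer \<Longrightarrow> z * u x - w x * u (\<phi> x) = f x"
      using BM(3)[OF C_space_restrict[OF f invM(3)]] by auto
    obtain v where v: "v \<in> C_space X core" "\<And>x. x \<in> core \<Longrightarrow> z * v x - w x * v (\<phi> x) = f x"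
      using BL(3)[OF C_space_restrict[OF f invL(3)]] by auto
    have u_le: "cmod (u x) \<le> BM * N" if "x \<in> outer" for x
      using u f_le invM(3) that by (intro BM(2)) auto
    have v_le: "cmod (v x) \<le> BL * N" if "x \<in> core" for x
      using v f_le invL(3) that by (intro BL(2)) auto
    have agree: "u x - v x = 0" if "x \<in> outer \<inter> core" for x
    proof (rule decay_imp_zero[where E = "outer \<inter> core" and d = "\<lambda>x. u x - v x", OF _ _ q _ _ that])
      show "\<phi> x \<in> outer \<inter> core" if "x \<in> outer \<inter> core" for x
        using that invM(4) invL(4) by auto
      show "cmod (wt n k) \<le> D * q ^ n" if "k \<in> outer \<inter> core" for n k
        using that decay by auto
      show "z * (u x - v x) = w x * (u (\<phi> x) - v (\<phi> x))" if "x \<in> outer \<inter> core" for x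
        using u(2)[of x] v(2)[of x] that by (simp add: algebra_simps)
      show "cmod (u x - v x) \<le> BM * N + BL * N" if "x \<in> outer \<inter> core" for x
        using that by (intro order_trans[OF norm_triangle_ineq4 add_mono] u_le v_le) auto
    qed
    define h where "h x = (if x \<in> outer then u x else v x)" for x
    have h_core: "h x = v x" if "x \<in> core" for x
      using agree[of x] that by (auto simp: h_def)
    have "h \<in> C_space X (topspace X)"
      unfolding h_def[abs_def] using u(1) v(1) agree by (intro C_space_glue) auto
    moreover have "z * h x - w x * h (\<phi> x) = f x \<and> cmod (h x) \<le> (BM + BL) * N"
      if x: "x \<in> topspace X" for x
    proof (cases "x \<in> outer")
      case True
      then show ?thesis
        using u(2) u_le[of x] invM(4) BL(1) \<open>0 \<le> N\<close>
        by (simp add: h_def distrib_right add_increasing2)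
    next
      case False
      then have "x \<in> core" using noncore_subset_outer x by auto
      then show ?thesis
        using v(2) v_le[of x] invL(4) BM(1) \<open>0 \<le> N\<close> by (simp add: h_core distrib_right add_increasing)
    qed
    ultimately show "\<exists>u\<in>C_space X (topspace X). (\<forall>x\<in>topspace X. z * u x - w x * u (\<phi> x) = f x) \<and>
        (\<forall>x\<in>topspace X. cmod (u x) \<le> (BM + BL) * sup_norm (topspace X) f)"
      by (auto simp: N_def)
  next
    fix u x
    assume u: "u \<in> C_space X (topspace X)" "\<And>x. x \<in> topspace X \<Longrightarrow> z * u x = w x * u (\<phi> x)"
      and x: "x \<in> topspace X"
    show "u x = 0"
    proof (cases "x \<in> outer")
      case True
      then show ?thesis
        \<comment> \<open>The restriction lies in the kernel on \<open>outer\<close>; the estimate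
          with bound 0 forces it to vanish.\<close>
        using BM(2)[OF C_space_restrict[OF u(1) invM(3)], of 0 x] u(2) invM(3,4) by (auto simp: subset_iff)
    next
      case False
      then have "x \<in> core" using noncore_subset_outer x by auto
      then show ?thesis
        using BL(2)[OF C_space_restrict[OF u(1) invL(3)], of 0 x] u(2) invL(3,4) by (auto simp: subset_iff)
    qed
  qed
qed

text \<open>Decay on \<open>outer\<close> already settles \<open>C(M)\<close>. On
  \<open>C(L)\<close>, right-hand sides are extended to the whole space and solutions restricted;
  kernel elements are extended by zero.\<close>

lemma not_in_spectrum_topspaceD:
  assumes z: "z \<notin> spectrum X (topspace X) (weighted_comp (topspace X) w \<phi>)"
  shows "z \<notin> spectrum X outer (weighted_comp outer w \<phi>)"
    and "z \<notin> spectrum X core (weighted_comp core w \<phi>)"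
proof -
  note invM = closed_invariantD[OF closed_invariant_outer]
    and invL = closed_invariantD[OF closed_invariant_core]
  have "z \<noteq> 0"
    using z zero_in_spectrum[OF closed_invariant_topspace] by (metis Diff_subset)
  then obtain D q where q: "0 \<le> q" "q < cmod z"
    and decay: "\<And>n k. k \<in> outer \<Longrightarrow> cmod (wt n k) \<le> D * q ^ n"
    using resolvent_imp_decay[OF closed_invariant_topspace Diff_subset _ z] by metis
  then show "z \<notin> spectrum X outer (weighted_comp outer w \<phi>)"
    by (rule decay_imp_not_in_spectrum[OF closed_invariant_outer])
  obtain B where B: "0 \<le> B" "\<And>u b x. u \<in> C_space X (topspace X) \<Longrightarrow>
      (\<And>x. x \<in> topspace X \<Longrightarrow> cmod (z * u x - w x * u (\<phi> x)) \<le> b) \<Longrightarrow> x \<in> topspace X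
      \<Longrightarrow> cmod (u x) \<le> B * b"
    "\<And>f. f \<in> C_space X (topspace X) \<Longrightarrow>
      \<exists>u\<in>C_space X (topspace X). \<forall>x\<in>topspace X. z * u x - w x * u (\<phi> x) = f x"
    using not_in_spectrumD[OF closed_invariant_topspace z] by metis
  show "z \<notin> spectrum X core (weighted_comp core w \<phi>)"
  proof (rule not_in_spectrumI[OF closed_invariant_core])
    fix f assume f: "f \<in> C_space X core"
    obtain g where g: "g \<in> C_space X (topspace X)" "\<And>x. x \<in> core \<Longrightarrow> g x = f x"
      "\<And>x. x \<in> topspace X \<Longrightarrow> cmod (g x) \<le> 2 * sup_norm core f"
      using C_space_extension[OF invL(1,2) f] by metis
    obtain u where u: "u \<in> C_space X (topspace X)"
      "\<And>x. x \<in> topspace X \<Longrightarrow> z * u x - w x * u (\<phi> x) = g x"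
      using B(3)[OF g(1)] by auto
    have u_le: "cmod (u x) \<le> B * (2 * sup_norm core f)" if "x \<in> topspace X" for x
      using u g(3) that by (intro B(2)) auto
    show "\<exists>u\<in>C_space X core. (\<forall>x\<in>core. z * u x - w x * u (\<phi> x) = f x) \<and>
        (\<forall>x\<in>core. cmod (u x) \<le> (2 * B) * sup_norm core f)"
      using u(2) u_le g(2) invL(3,4)
      by (intro bexI[OF _ C_space_restrict[OF u(1) invL(3)]]) (auto simp: subset_iff mult_ac)
  next
    fix u x
    assume u: "u \<in> C_space X core" "\<And>x. x \<in> core \<Longrightarrow> z * u x = w x * u (\<phi> x)" and x: "x \<in> core"
    \<comment> \<open>Vanishing on the overlap is what makes the extension by zero
      continuous.\<close>
    have boundary: "u y = 0" if "y \<in> outer \<inter> core" for y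
    proof (rule decay_imp_zero[where E = "outer \<inter> core" and d = u, OF _ _ q _ _ that])
      show "\<phi> x \<in> outer \<inter> core" if "x \<in> outer \<inter> core" for x
        using that invM(4) invL(4) by auto
      show "cmod (wt n k) \<le> D * q ^ n" if "k \<in> outer \<inter> core" for n k
        using that decay by auto
      show "z * u x = w x * u (\<phi> x)" if "x \<in> outer \<inter> core" for x
        using that u(2) by auto
      show "cmod (u x) \<le> sup_norm core u" if "x \<in> outer \<inter> core" for x
        using that by (intro norm_le_sup_norm[OF compact invL(1) u(1)]) auto
    qed
    then have "(\<lambda>x. if x \<in> outer then 0 else u x) \<in> C_space X (topspace X)"
      using u(1) by (intro C_space_glue C_space_zero) auto
    moreover have "(\<lambda>x. if x \<in> outer then 0 else u x) = u"
      using boundary C_spaceD(2)[OF u(1)] by fastforce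
    ultimately have uK: "u \<in> C_space X (topspace X)" by simp
    \<comment> \<open>The extension stays in the kernel: off the core, \<open>\<phi> y\<close> is
      off the core too, so both terms are 0.\<close>
    have "z * u y - w y * u (\<phi> y) = 0" if "y \<in> topspace X" for y
    proof (cases "y \<in> core")
      case False
      then have "u y = 0" "u (\<phi> y) = 0"
        using C_spaceD(2)[OF u(1)] core_preimage that by blast+
      then show ?thesis by simp
    qed (use u(2) in simp)
    then have "cmod (u x) \<le> B * 0"
      using uK x invL(3) by (intro B(2)) auto
    then show "u x = 0" by simp
  qed
qed

end

theorem theorem3p1:
  fixes X :: "'a topology" and \<phi> :: "'a \<Rightarrow> 'a" and w :: "'a \<Rightarrow> complex" and L M :: "'a set"
  assumes "compact_space X" and "Hausdorff_space X"
    and "continuous_map X X \<phi>" and "inj_on \<phi> (topspace X)"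
    and "\<phi> ` topspace X \<subset> topspace X"
    and "continuous_map X euclidean w"
    and L: "L = (\<Inter>n. (\<phi> ^^ n) ` topspace X)"
    and M: "M = topspace X - X interior_of L"
  shows "(spectrum X M (weighted_comp M w \<phi>) =
            (\<lambda>z. complex_of_real (spectral_radius X M (weighted_comp M w \<phi>)) * z) ` cball 0 1
          \<or> spectrum X M (weighted_comp M w \<phi>) = {0})
       \<and> spectrum X (topspace X) (weighted_comp (topspace X) w \<phi>) =
            spectrum X M (weighted_comp M w \<phi>) \<union> spectrum X L (weighted_comp L w \<phi>)"
proof -
  interpret weighted_injection X \<phi> w
    using assms(1-6) by unfold_locales
  have "L = core" "M = outer"
    by (simp_all add: L M core_def outer_def)
  then show ?thesis
    using spectrum_outer_eq_disc not_in_spectrum_topspaceI not_in_spectrum_topspaceD by blast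
qed

end
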